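(* Let $0<\alpha<1$, $\varepsilon>0$, and let $u^0,u^1,\dots,u^N\in\mathbb{V}_h$ be the solution of the stabilized semi-implicit scheme $$(\partial_f^\alpha u)^n=\varepsilon^2 D_h u^n-f(u^{n-1})-S(u^n-u^{n-1}),\quad 1\le n\le N,\qquad u_h^0=u_0(\mathbf{x}_h)\ \text{ at all grid points }\mathbf{x}_h,$$ where $f(v)=v^3-v$ is applied componentwise, on an arbitrary (possibly nonuniform) time mesh $0=t_0<t_1<\dots<t_N=T$. If $\|u^0\|_\infty\le1$ and the scalar stabilization parameter satisfies $S\ge2$, then $$\|u^k\|_\infty\le1\quad\text{for all }0\le k\le N.$$ That is, the scheme preserves the discrete counterpart of the maximum principle "$|u(\mathbf{x},t)|\le 1$ for $t>0$ if $|u(\mathbf{x},0)|\le1$" and, in this sense, is unconditionally stable in the maximum norm.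
   Context: The continuous problem is the time-fractional Allen-Cahn equation $\partial_t^\alpha u=\varepsilon^2\Delta u-f(u)$ on $\Omega=(a,b)\times(c,d)$, $0<t\le T$, with periodic boundary conditions, $u(\mathbf{x},0)=u_0(\mathbf{x})$, $f(u)=u^3-u$, where $\partial_t^\alpha$ is the Caputo derivative of order $\alpha\in(0,1)$, $(\partial_t^\alpha v)(t)=\int_0^t\omega_{1-\alpha}(t-s)v'(s)\,ds$, and $\omega_\mu(t):=t^{\mu-1}/\Gamma(\mu)$. Time mesh: $0=t_0<t_1<\dots<t_N=T$, $\tau_k:=t_k-t_{k-1}$, and $\nabla_\tau v^k:=v^k-v^{k-1}$. Sum-of-exponentials (SOE) approximation: for the tolerance $\epsilon>0$ and the cut-off time $\Delta t>0$, with $\Delta t\le\min_k\tau_k$, there are fixed a positive integer $N_q$, positive nodes $\theta^\ell$ and positive weights $\varpi^\ell$ ($1\le\ell\le N_q$) with $\left|\omega_{1-\alpha}(t)-\sum_{\ell=1}^{N_q}\varpi^\ell e^{-\theta^\ell t}\right|\le\epsilon$ for all $t\in[\Delta t,T]$. Fast L1 formula: $(\partial_f^\alpha v)^n:=\sum_{k=1}^n A_{n-k}^{(n)}\nabla_\tau v^k$, $n\ge1$, where $$A_0^{(n)}:=a_0^{(n)},\qquad A_{n-k}^{(n)}:=\frac1{\tau_k}\int_{t_{k-1}}^{t_k}\sum_{\ell=1}^{N_q}\varpi^\ell e^{-\theta^\ell(t_n-s)}\,ds\quad(1\le k\le n-1),$$ $$a_{n-k}^{(n)}:=\frac1{\tau_k}\int_{t_{k-1}}^{t_k}\omega_{1-\alpha}(t_n-s)\,ds\quad(1\le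 k\le n),$$ so that $A_0^{(n)}=\tau_n^{-\alpha}/\Gamma(2-\alpha)$. Standing assumption: $\epsilon\le\min\{\tfrac13\omega_{1-\alpha}(T),\ \alpha\,\omega_{2-\alpha}(1)\}$, together with the resulting kernel properties (known from the literature and taken as given): (i) $A_{k-1}^{(n)}>A_k^{(n)}>0$ for $1\le k\le n-1$; (ii) $A_{n-k}^{(n)}\ge\frac23 a_{n-k}^{(n)}$ for $1\le k\le n-1$. Spatial discretization: $M_1,M_2$ are positive integers ($\ge3$), $h_1=(b-a)/M_1$, $h_2=(d-c)/M_2$, $x_i=a+ih_1$, $y_j=c+jh_2$, $\mathbf{x}_h=(x_i,y_j)$. $\mathbb{V}_h$ is the space of real grid vectors $v=(v_{i,j})$, $0\le i\le M_1-1$, $0\le j\le M_2-1$ (extended periodically), ordered with $i$ running fastest. $\|v\|_\infty$ is the maximum of $|v_{i,j}|$ over the grid. $D_h=I_1\otimes D_1+D_2\otimes I_2$ is the periodic five-point discrete Laplacian, where $I_1,I_2$ are identity matrices of orders $M_2$ and $M_1$, and $D_1$ (order $M_1$), $D_2$ (order $M_2$) are $h_1^{-2}$, respectively $h_2^{-2}$, times the circulant matrix with $-2$ on the diagonal, $1$ on the two adjacent off-diagonals, and $1$ in the top-right and bottom-left corners. *)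

theory Defs
  imports "HOL-Analysis.Analysis" "Jordan_Normal_Form.Matrix"
begin

unbundle no vec_syntax
hide_type (open) Finite_Cartesian_Product.vec
hide_const (open) Finite_Cartesian_Product.vec Determinants.det

definition omega :: "real \<Rightarrow> real \<Rightarrow> real" where
  "omega \<mu> t = t powr (\<mu> - 1) / Gamma \<mu>"

definition tau :: "(nat \<Rightarrow> real) \<Rightarrow> nat \<Rightarrow> real" where
  "tau t k = t k - t (k - 1)"

definition soe :: "nat \<Rightarrow> (nat \<Rightarrow> real) \<Rightarrow> (nat \<Rightarrow> real) \<Rightarrow> real \<Rightarrow> real" where
  "soe Nq \<theta> w s = (\<Sum>l=1..Nq. w l * exp (- \<theta> l * s))"

text \<open>
  The coefficients carry the lower index \<open>j = n - k\<close>, where \<open>0 \<le> j \<le> n - 1\<close>, so the average is over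
  the interval from \<open>t (k - 1)\<close> to \<open>t k\<close> with \<open>k = n - j\<close>.  For \<open>j = 0\<close> the integrand of \<open>L1_coeff\<close> has an
  integrable singularity at the right end point, where \<open>omega (1 - \<alpha>) 0 = 0\<close> by the
  convention for \<open>powr\<close>; this does not affect the integral.
\<close>

definition L1_coeff :: "real \<Rightarrow> (nat \<Rightarrow> real) \<Rightarrow> nat \<Rightarrow> nat \<Rightarrow> real" where
  "L1_coeff \<alpha> t n j =
     (let k = n - j in
      1 / tau t k * integral {t (k - 1)..t k} (\<lambda>s. omega (1 - \<alpha>) (t n - s)))"

definition fast_coeff ::
  "real \<Rightarrow> nat \<Rightarrow> (nat \<Rightarrow> real) \<Rightarrow> (nat \<Rightarrow> real) \<Rightarrow> (nat \<Rightarrow> real) \<Rightarrow> nat \<Rightarrow> nat \<Rightarrow> real" where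
  "fast_coeff \<alpha> Nq \<theta> w t n j =
     (if j = 0 then L1_coeff \<alpha> t n 0
      else let k = n - j in
        1 / tau t k * integral {t (k - 1)..t k} (\<lambda>s. soe Nq \<theta> w (t n - s)))"

definition fast_L1 ::
  "real \<Rightarrow> nat \<Rightarrow> (nat \<Rightarrow> real) \<Rightarrow> (nat \<Rightarrow> real) \<Rightarrow> (nat \<Rightarrow> real) \<Rightarrow> (nat \<Rightarrow> real) \<Rightarrow> nat \<Rightarrow> real" where
  "fast_L1 \<alpha> Nq \<theta> w t v n =
     (\<Sum>k=1..n. fast_coeff \<alpha> Nq \<theta> w t n (n - k) * (v k - v (k - 1)))"

definition fast_L1_vec ::
  "real \<Rightarrow> nat \<Rightarrow> (nat \<Rightarrow> real) \<Rightarrow> (nat \<Rightarrow> real) \<Rightarrow> (nat \<Rightarrow> real) \<Rightarrow> (nat \<Rightarrow> real vec) \<Rightarrow> nat \<Rightarrow> real vec" where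
  "fast_L1_vec \<alpha> Nq \<theta> w t v n =
     vec (dim_vec (v n)) (\<lambda>p. fast_L1 \<alpha> Nq \<theta> w t (\<lambda>k. v k $ p) n)"

text \<open>
  A grid vector on the \<open>M1\<close> by \<open>M2\<close> periodic grid is an element of \<open>carrier_vec (M1 * M2)\<close>; the value at
  \<open>(x_i, y_j)\<close> sits at position \<open>i + j * M1\<close>, so \<open>i\<close> runs fastest.
\<close>

definition kronecker :: "real mat \<Rightarrow> real mat \<Rightarrow> real mat" where
  "kronecker A B =
     mat (dim_row A * dim_row B) (dim_col A * dim_col B)
       (\<lambda>(p, q). A $$ (p div dim_row B, q div dim_col B) * B $$ (p mod dim_row B, q mod dim_col B))"

definition periodic_D :: "nat \<Rightarrow> real \<Rightarrow> real mat" where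
  "periodic_D m h = (1 / h\<^sup>2) \<cdot>\<^sub>m
     mat m m (\<lambda>(i, j).
       if i = j then - 2
       else if j = i + 1 \<or> i = j + 1 then 1
       else if (i = 0 \<and> j = m - 1) \<or> (i = m - 1 \<and> j = 0) then 1
       else 0)"

definition discrete_laplacian :: "nat \<Rightarrow> nat \<Rightarrow> real \<Rightarrow> real \<Rightarrow> real mat" where
  "discrete_laplacian M1 M2 h1 h2 =
     kronecker (1\<^sub>m M2) (periodic_D M1 h1) + kronecker (periodic_D M2 h2) (1\<^sub>m M1)"

definition max_norm :: "real vec \<Rightarrow> real" where
  "max_norm v = Max ((\<lambda>p. \<bar>v $ p\<bar>) ` {..<dim_vec v})"

definition AC_f :: "real \<Rightarrow> real" where
  "AC_f x = x ^ 3 - x"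

end

theory Submission
  imports Defs
begin

text \<open>
  The argument is a discrete maximum principle.  Summation by parts turns the fast L1 formula at level
  \<open>n\<close> into \<open>A\<^sub>0 u\<^sup>n\<close> minus a combination of the earlier values, and since the kernel is nonnegative and
  decreasing, the weights of that combination are nonnegative and add up to \<open>A\<^sub>0\<close>
  (\<open>discrete_convolution_history_bound\<close>).  The scheme therefore reads
  \<open>(A\<^sub>0 + S) u\<^sup>n = \<epsilon>\<^sup>2 D\<^sub>h u\<^sup>n + R\<close>, where \<open>R\<close> depends on \<open>u\<^sup>0, \<dots>, u\<^sup>n\<^sup>-\<^sup>1\<close> only.
  If those vectors take values in \<open>[-1, 1]\<close>, the history contributes at most \<open>A\<^sub>0\<close> to \<open>\<bar>R\<bar>\<close>.  The
  reaction contributes \<open>S x - f x\<close>, which for \<open>S \<ge> 2\<close> is an increasing function of \<open>x\<close> on \<open>[-1, 1]\<close>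
  with values \<open>\<plusminus>S\<close> at the end points, so at most \<open>S\<close> (\<open>stabilized_reaction_bound\<close>).

  At a grid point where \<open>\<bar>u\<^sup>n\<bar>\<close> is largest, \<open>D\<^sub>h u\<^sup>n\<close> is zero or opposite in sign to \<open>u\<^sup>n\<close>
  (\<open>rate_matrix_at_max_abs\<close>), because \<open>D\<^sub>h\<close> has nonnegative off-diagonal entries and vanishing
  row sums.  Hence \<open>(A\<^sub>0 + S) \<bar>u\<^sup>n\<bar> \<le> \<bar>R\<bar> \<le> A\<^sub>0 + S\<close> at that point, and induction on \<open>n\<close> gives
  the theorem.
\<close>

section \<open>Matrices obeying a maximum principle\<close>

text \<open>
  These are the generators of finite continuous-time Markov chains.  The conditions are stable under sums
  and under Kronecker products with an identity, so the two-dimensional Laplacian inherits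
  them from the one-dimensional one.
\<close>

definition rate_matrix :: "nat \<Rightarrow> real mat \<Rightarrow> bool" where
  "rate_matrix m A \<longleftrightarrow> A \<in> carrier_mat m m
     \<and> (\<forall>i<m. \<forall>j<m. i \<noteq> j \<longrightarrow> 0 \<le> A $$ (i, j))
     \<and> (\<forall>i<m. (\<Sum>j<m. A $$ (i, j)) = 0)"

text \<open>
  Vanishing row sums allow \<open>v p\<close> to be subtracted from every \<open>v q\<close>; with \<open>s\<close> the sign of \<open>v p\<close>, each
  difference \<open>s (v q - v p)\<close> is nonpositive, and it carries a nonnegative weight unless it is the zero
  difference at \<open>q = p\<close>.
\<close>

lemma rate_matrix_at_max_abs:
  assumes A: "rate_matrix m A" and v: "v \<in> carrier_vec m" and p: "p < m"
    and max: "\<And>q. q < m \<Longrightarrow> \<bar>v $ q\<bar> \<le> \<bar>v $ p\<bar>"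
  shows "sgn (v $ p) * (A *\<^sub>v v) $ p \<le> 0"
proof -
  let ?s = "sgn (v $ p)"
  have rows: "(\<Sum>q<m. A $$ (p, q)) = 0" using A p by (auto simp: rate_matrix_def)
  have "(A *\<^sub>v v) $ p = (\<Sum>q<m. A $$ (p, q) * v $ q)"
    using A v p
    by (auto simp: rate_matrix_def scalar_prod_def lessThan_atLeast0 intro!: sum.cong)
  then have "?s * (A *\<^sub>v v) $ p
      = (\<Sum>q<m. A $$ (p, q) * (?s * v $ q)) - \<bar>v $ p\<bar> * (\<Sum>q<m. A $$ (p, q))"
    using rows by (simp add: sum_distrib_left algebra_simps)
  also have "\<dots> = (\<Sum>q<m. A $$ (p, q) * (?s * v $ q - \<bar>v $ p\<bar>))"
    by (simp add: sum_distrib_left sum_subtractf algebra_simps)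
  also have "\<dots> \<le> 0"
  proof (rule sum_nonpos)
    fix q assume "q \<in> {..<m}"
    then have q: "q < m" by simp
    show "A $$ (p, q) * (?s * v $ q - \<bar>v $ p\<bar>) \<le> 0"
    proof (cases "q = p")
      case True
      then show ?thesis by (simp add: abs_sgn mult.commute)
    next
      case False
      have "0 \<le> A $$ (p, q)" using A p q False by (auto simp: rate_matrix_def)
      moreover have "?s * v $ q \<le> \<bar>v $ p\<bar>"
        using max[OF q] by (auto simp: sgn_real_def)
      ultimately show ?thesis by (simp add: mult_nonneg_nonpos)
    qed
  qed
  finally show ?thesis .
qed

lemma rate_matrix_add:
  assumes "rate_matrix m A" "rate_matrix m B"
  shows "rate_matrix m (A + B)"
  using assms by (auto simp: rate_matrix_def sum.distrib)

section \<open>The periodic discrete Laplacian\<close>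

text \<open>
  For \<open>m \<ge> 3\<close> the diagonal position and the two cyclic neighbours are three different columns, so the row
  contains \<open>-2\<close>, \<open>1\<close>, \<open>1\<close> and zeros.
\<close>

lemma rate_matrix_periodic_D:
  assumes m: "3 \<le> m"
  shows "rate_matrix m (periodic_D m h)"
proof -
  have "(\<Sum>j<m. periodic_D m h $$ (i, j)) = 0" if i: "i < m" for i
  proof -
    define e :: "nat \<Rightarrow> nat \<Rightarrow> real" where "e k j = (if j = k then 1 else 0)" for k j
    define succ where "succ = (if i = m - 1 then 0 else i + 1)"
    define pred where "pred = (if i = 0 then m - 1 else i - 1)"
    have sum_e: "(\<Sum>j<m. e k j) = 1" if "k < m" for k
      using that by (simp add: e_def)
    have range: "succ < m" "pred < m" and distinct: "succ \<noteq> i" "pred \<noteq> i" "succ \<noteq> pred"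
      using i m by (auto simp: succ_def pred_def split: if_splits)
    have entry: "periodic_D m h $$ (i, j) = 1 / h\<^sup>2 * (- 2 * e i j + e succ j + e pred j)"
      if j: "j < m" for j
    proof -
      consider (diagonal) "j = i" | (succ) "j = succ" | (pred) "j = pred"
        | (far) "j \<noteq> i" "j \<noteq> succ" "j \<noteq> pred"
        by blast
      then show ?thesis
      proof cases
        case diagonal
        then show ?thesis using i distinct by (simp add: periodic_D_def e_def)
      next
        case succ
        then have "i \<noteq> j" "j = i + 1 \<or> i = m - 1 \<and> j = 0" "j \<noteq> pred"
          using distinct by (auto simp: succ_def)
        then show ?thesis using i j succ by (auto simp: periodic_D_def e_def)
      next
        case pred
        then have "i \<noteq> j" "i = j + 1 \<or> i = 0 \<and> j = m - 1" "j \<noteq> succ"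
          using distinct by (auto simp: pred_def split: if_splits)
        then show ?thesis using i j pred by (auto simp: periodic_D_def e_def)
      next
        case far
        then have "i \<noteq> j" "j \<noteq> i + 1" "i \<noteq> j + 1" "\<not> (i = 0 \<and> j = m - 1)" "\<not> (i = m - 1 \<and> j = 0)"
          using j by (auto simp: succ_def pred_def split: if_splits)
        then show ?thesis using i j far by (auto simp: periodic_D_def e_def)
      qed
    qed
    have "(\<Sum>j<m. periodic_D m h $$ (i, j))
        = (\<Sum>j<m. 1 / h\<^sup>2 * (- 2 * e i j + e succ j + e pred j))"
      by (intro sum.cong) (simp_all add: entry)
    also have "\<dots> = 1 / h\<^sup>2 * (- 2 * (\<Sum>j<m. e i j) + (\<Sum>j<m. e succ j) + (\<Sum>j<m. e pred j))"
      by (simp only: sum.distrib sum_distrib_left[symmetric])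
    also have "\<dots> = 0" using i range by (simp add: sum_e)
    finally show ?thesis .
  qed
  then show ?thesis by (auto simp: rate_matrix_def periodic_D_def)
qed

lemma sum_div_mod_product:
  fixes f g :: "nat \<Rightarrow> real"
  shows "(\<Sum>q<M1 * M2. f (q div M1) * g (q mod M1)) = (\<Sum>j<M2. f j) * (\<Sum>i<M1. g i)"
proof -
  have "(\<Sum>q<M1 * M2. f (q div M1) * g (q mod M1))
      = (\<Sum>j<M2. \<Sum>q = j * M1..<j * M1 + M1. f (q div M1) * g (q mod M1))"
    by (simp add: sum.nat_group mult.commute)
  also have "\<dots> = (\<Sum>j<M2. \<Sum>i<M1. f j * g i)"
  proof (rule sum.cong[OF refl])
    fix j
    have "(\<Sum>q = j * M1..<j * M1 + M1. f (q div M1) * g (q mod M1))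
        = (\<Sum>i = 0..<M1. f ((i + j * M1) div M1) * g ((i + j * M1) mod M1))"
      using sum.shift_bounds_nat_ivl[of "\<lambda>q. f (q div M1) * g (q mod M1)" 0 "j * M1" M1]
      by (simp add: add.commute)
    also have "\<dots> = (\<Sum>i<M1. f j * g i)"
      by (intro sum.cong) auto
    finally show "(\<Sum>q = j * M1..<j * M1 + M1. f (q div M1) * g (q mod M1))
      = (\<Sum>i<M1. f j * g i)" .
  qed
  finally show ?thesis by (simp add: sum_product)
qed

lemma row_sum_kronecker:
  assumes "A \<in> carrier_mat M2 M2" "B \<in> carrier_mat M1 M1" "p < M1 * M2"
  shows "(\<Sum>q<M1 * M2. kronecker A B $$ (p, q))
    = (\<Sum>j<M2. A $$ (p div M1, j)) * (\<Sum>i<M1. B $$ (p mod M1, i))"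
proof -
  have "kronecker A B $$ (p, q) = A $$ (p div M1, q div M1) * B $$ (p mod M1, q mod M1)"
    if "q < M1 * M2" for q
    using assms that by (simp add: kronecker_def mult.commute)
  then show ?thesis
    by (simp add: sum_div_mod_product[symmetric])
qed

lemma rate_matrix_discrete_laplacian:
  assumes M: "3 \<le> M1" "3 \<le> M2"
  shows "rate_matrix (M1 * M2) (discrete_laplacian M1 M2 h1 h2)"
proof -
  have D: "rate_matrix M1 (periodic_D M1 h1)" "rate_matrix M2 (periodic_D M2 h2)"
    using M by (simp_all add: rate_matrix_periodic_D)
  then have car: "periodic_D M1 h1 \<in> carrier_mat M1 M1" "periodic_D M2 h2 \<in> carrier_mat M2 M2"
    by (simp_all add: rate_matrix_def)
  have idx: "p div M1 < M2" "p mod M1 < M1" if "p < M1 * M2" for p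
    using that M by (auto simp: less_mult_imp_div_less mult.commute)
  have neq: "p div M1 \<noteq> q div M1 \<or> p mod M1 \<noteq> q mod M1" if "p \<noteq> q" for p q
    using that by (metis div_mult_mod_eq)
  \<comment> \<open>A row sum of a Kronecker product factors, and the Laplacian's factor vanishes; off the diagonal,
    the identity factor is zero unless the Laplacian's factor is also taken off the diagonal.\<close>
  have x: "rate_matrix (M1 * M2) (kronecker (1\<^sub>m M2) (periodic_D M1 h1))"
    unfolding rate_matrix_def
  proof (intro conjI allI impI)
    show "kronecker (1\<^sub>m M2) (periodic_D M1 h1) \<in> carrier_mat (M1 * M2) (M1 * M2)"
      using car by (auto simp: kronecker_def)
  next
    fix p q assume "p < M1 * M2" "q < M1 * M2" "p \<noteq> q"
    then show "0 \<le> kronecker (1\<^sub>m M2) (periodic_D M1 h1) $$ (p, q)"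
      using car D(1) idx[of p] idx[of q] neq[of p q]
      by (auto simp: kronecker_def rate_matrix_def mult.commute[of M2])
  next
    fix p assume p: "p < M1 * M2"
    then show "(\<Sum>q<M1 * M2. kronecker (1\<^sub>m M2) (periodic_D M1 h1) $$ (p, q)) = 0"
      using row_sum_kronecker[OF _ car(1) p, of "1\<^sub>m M2"] D(1) idx[OF p]
      by (auto simp: rate_matrix_def)
  qed
  have y: "rate_matrix (M1 * M2) (kronecker (periodic_D M2 h2) (1\<^sub>m M1))"
    unfolding rate_matrix_def
  proof (intro conjI allI impI)
    show "kronecker (periodic_D M2 h2) (1\<^sub>m M1) \<in> carrier_mat (M1 * M2) (M1 * M2)"
      using car by (auto simp: kronecker_def)
  next
    fix p q assume "p < M1 * M2" "q < M1 * M2" "p \<noteq> q"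
    then show "0 \<le> kronecker (periodic_D M2 h2) (1\<^sub>m M1) $$ (p, q)"
      using car D(2) idx[of p] idx[of q] neq[of p q]
      by (auto simp: kronecker_def rate_matrix_def mult.commute[of M2])
  next
    fix p assume p: "p < M1 * M2"
    then show "(\<Sum>q<M1 * M2. kronecker (periodic_D M2 h2) (1\<^sub>m M1) $$ (p, q)) = 0"
      using row_sum_kronecker[OF car(2) _ p, of "1\<^sub>m M1"] D(2) idx[OF p]
      by (auto simp: rate_matrix_def)
  qed
  show ?thesis
    unfolding discrete_laplacian_def by (rule rate_matrix_add[OF x y])
qed

section \<open>History and reaction terms\<close>

text \<open>
  The quantity inside the bars is \<open>(b\<^sub>0 - b\<^sub>1) v\<^sup>n\<^sup>-\<^sup>1 + \<dots> + (b\<^sub>n\<^sub>-\<^sub>2 - b\<^sub>n\<^sub>-\<^sub>1) v\<^sup>1 + b\<^sub>n\<^sub>-\<^sub>1 v\<^sup>0\<close>,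
  whose weights telescope to \<open>b\<^sub>0\<close>.  Splitting off the last increment leaves a convolution of length
  \<open>n - 1\<close> with the shifted kernel, which gives the induction.
\<close>

lemma discrete_convolution_history_bound:
  fixes b v :: "nat \<Rightarrow> real"
  assumes "1 \<le> n"
    and "\<And>j. j < n \<Longrightarrow> 0 \<le> b j"
    and "\<And>j. Suc j < n \<Longrightarrow> b (Suc j) \<le> b j"
    and "\<And>k. k < n \<Longrightarrow> \<bar>v k\<bar> \<le> 1"
  shows "\<bar>b 0 * v n - (\<Sum>k=1..n. b (n - k) * (v k - v (k - 1)))\<bar> \<le> b 0"
  using assms
proof (induction n arbitrary: b rule: nat_induct_at_least)
  case base
  have "\<bar>b 0 * v 0\<bar> \<le> b 0 * 1"
    unfolding abs_mult using base(1)[of 0] base(3)[of 0] by (intro mult_mono) auto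
  then show ?case by (simp add: algebra_simps)
next
  case (Suc n)
  let ?H = "b 1 * v n - (\<Sum>k=1..n. b (Suc (n - k)) * (v k - v (k - 1)))"
  have "(\<Sum>k=1..n. b (Suc n - k) * (v k - v (k - 1)))
      = (\<Sum>k=1..n. b (Suc (n - k)) * (v k - v (k - 1)))"
    by (intro sum.cong) (auto simp: Suc_diff_le)
  then have split: "b 0 * v (Suc n) - (\<Sum>k=1..Suc n. b (Suc n - k) * (v k - v (k - 1)))
      = (b 0 - b 1) * v n + ?H"
    by (simp add: algebra_simps)
  have "\<bar>?H\<bar> \<le> b 1"
    using Suc.IH[of "\<lambda>j. b (Suc j)"] Suc.prems by simp
  moreover have "\<bar>(b 0 - b 1) * v n\<bar> \<le> (b 0 - b 1) * 1"
    unfolding abs_mult using Suc.prems(2)[of 0] Suc.prems(3)[of n] Suc.hyps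
    by (intro mult_mono) auto
  moreover have "\<bar>(b 0 - b 1) * v n + ?H\<bar> \<le> \<bar>(b 0 - b 1) * v n\<bar> + \<bar>?H\<bar>"
    by (rule abs_triangle_ineq)
  ultimately show ?case unfolding split by argo
qed

text \<open>
  Both inequalities come from factoring out the root at the end point:
  \<open>S - (S x - f x) = (1 - x) (S - x - x\<^sup>2)\<close>, and \<open>x + x\<^sup>2 \<le> 2\<close> on \<open>[-1, 1]\<close>; the function is odd.
\<close>

lemma stabilized_reaction_bound:
  assumes S: "2 \<le> S" and x: "\<bar>x\<bar> \<le> 1"
  shows "\<bar>S * x - AC_f x\<bar> \<le> S"
proof -
  have upper: "S * y - AC_f y \<le> S" if y: "\<bar>y\<bar> \<le> 1" for y
  proof -
    have "y\<^sup>2 \<le> 1" using y by (simp add: abs_square_le_1)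
    then have "0 \<le> (1 - y) * (S - y - y\<^sup>2)"
      using S y by (intro mult_nonneg_nonneg) auto
    then show ?thesis by (simp add: AC_f_def algebra_simps power2_eq_square power3_eq_cube)
  qed
  from upper[of x] upper[of "- x"] x show ?thesis by (simp add: AC_f_def abs_le_iff)
qed

text \<open>
  Only the sign matters, so the integrability of the weak singularity at \<open>t n\<close> is not examined: a
  function that is not integrable has integral \<open>0\<close> by convention.
\<close>

lemma L1_coeff_0_nonneg:
  assumes "0 < \<alpha>" "\<alpha> < 1" "t (n - 1) < t n"
  shows "0 \<le> L1_coeff \<alpha> t n 0"
proof -
  have "0 \<le> integral {t (n - 1)..t n} (\<lambda>s. omega (1 - \<alpha>) (t n - s))"
  proof (cases "(\<lambda>s. omega (1 - \<alpha>) (t n - s)) integrable_on {t (n - 1)..t n}")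
    case True
    then show ?thesis
      using assms by (intro integral_nonneg) (auto simp: omega_def intro!: divide_nonneg_nonneg)
  qed (simp add: not_integrable_integral)
  then show ?thesis using assms by (simp add: L1_coeff_def tau_def)
qed

section \<open>The discrete maximum principle\<close>

lemma max_norm_le_iff:
  assumes "0 < dim_vec v"
  shows "max_norm v \<le> r \<longleftrightarrow> (\<forall>p<dim_vec v. \<bar>v $ p\<bar> \<le> r)"
proof -
  have "(\<lambda>p. \<bar>v $ p\<bar>) ` {..<dim_vec v} \<noteq> {}" using assms by auto
  then show ?thesis by (auto simp: max_norm_def)
qed

lemma max_norm_attained:
  assumes "0 < dim_vec v"
  obtains p where "p < dim_vec v" "max_norm v = \<bar>v $ p\<bar>"
proof -
  have "(\<lambda>p. \<bar>v $ p\<bar>) ` {..<dim_vec v} \<noteq> {}" using assms by auto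
  then have "max_norm v \<in> (\<lambda>p. \<bar>v $ p\<bar>) ` {..<dim_vec v}"
    unfolding max_norm_def by (intro Max_in) auto
  then show ?thesis using that by auto
qed

text \<open>
  One time step.  The constant \<open>A\<close> stands for \<open>A\<^sub>0 + S\<close> and \<open>R\<close> for all terms known from earlier levels;
  multiplying the equation at an extremal point by the sign of \<open>v\<close> there discards the diffusion term.
\<close>

lemma rate_matrix_resolvent_bound:
  assumes G: "rate_matrix m G" and v: "v \<in> carrier_vec m" and m: "0 < m"
    and A: "0 < A" and \<kappa>: "0 \<le> \<kappa>"
    and eq: "\<And>p. p < m \<Longrightarrow> A * v $ p = \<kappa> * (G *\<^sub>v v) $ p + R p"
    and R: "\<And>p. p < m \<Longrightarrow> \<bar>R p\<bar> \<le> A"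
  shows "max_norm v \<le> 1"
proof -
  from v m obtain p where p: "p < m" and pmax: "max_norm v = \<bar>v $ p\<bar>"
    using max_norm_attained[of v] by auto
  have "\<bar>v $ q\<bar> \<le> \<bar>v $ p\<bar>" if "q < m" for q
    using max_norm_le_iff[of v "max_norm v"] v m that pmax by auto
  then have diffusion: "\<kappa> * (sgn (v $ p) * (G *\<^sub>v v) $ p) \<le> 0"
    using rate_matrix_at_max_abs[OF G v p] \<kappa> by (simp add: mult_nonneg_nonpos)
  have "A * \<bar>v $ p\<bar> = sgn (v $ p) * (A * v $ p)"
    by (simp add: abs_sgn)
  also have "\<dots> = \<kappa> * (sgn (v $ p) * (G *\<^sub>v v) $ p) + sgn (v $ p) * R p"
    unfolding eq[OF p] by (simp add: algebra_simps)
  also have "\<dots> \<le> \<bar>R p\<bar>"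
    using diffusion by (auto simp: sgn_real_def split: if_splits)
  also have "\<dots> \<le> A * 1" using R[OF p] by simp
  finally show ?thesis using A pmax by simp
qed

theorem theorem2p2:
  fixes \<alpha> \<epsilon> S T tol \<Delta>t a b c d h1 h2 :: real
    and N Nq M1 M2 :: nat
    and t \<theta> w :: "nat \<Rightarrow> real"
    and u0 :: "real \<times> real \<Rightarrow> real"
    and u :: "nat \<Rightarrow> real vec"
  assumes alpha: "0 < \<alpha>" "\<alpha> < 1"
    and eps: "0 < \<epsilon>"
    and domain: "a < b" "c < d"
    and mesh: "1 \<le> N" "t 0 = 0" "\<And>k. 1 \<le> k \<Longrightarrow> k \<le> N \<Longrightarrow> t (k - 1) < t k" "t N = T"
    and soe_params: "0 < tol" "0 < \<Delta>t" "\<Delta>t \<le> Min (tau t ` {1..N})" "1 \<le> Nq"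
      "\<And>l. 1 \<le> l \<Longrightarrow> l \<le> Nq \<Longrightarrow> 0 < \<theta> l"
      "\<And>l. 1 \<le> l \<Longrightarrow> l \<le> Nq \<Longrightarrow> 0 < w l"
    and soe_error: "\<And>s. \<Delta>t \<le> s \<Longrightarrow> s \<le> T \<Longrightarrow> \<bar>omega (1 - \<alpha>) s - soe Nq \<theta> w s\<bar> \<le> tol"
    and tol_small: "tol \<le> min (1 / 3 * omega (1 - \<alpha>) T) (\<alpha> * omega (2 - \<alpha>) 1)"
    and kernel_mono: "\<And>n k. 1 \<le> n \<Longrightarrow> n \<le> N \<Longrightarrow> 1 \<le> k \<Longrightarrow> k \<le> n - 1 \<Longrightarrow>
      fast_coeff \<alpha> Nq \<theta> w t n (k - 1) > fast_coeff \<alpha> Nq \<theta> w t n k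
      \<and> fast_coeff \<alpha> Nq \<theta> w t n k > 0"
    and kernel_lower: "\<And>n k. 1 \<le> n \<Longrightarrow> n \<le> N \<Longrightarrow> 1 \<le> k \<Longrightarrow> k \<le> n - 1 \<Longrightarrow>
      fast_coeff \<alpha> Nq \<theta> w t n (n - k) \<ge> 2 / 3 * L1_coeff \<alpha> t n (n - k)"
    and grid: "3 \<le> M1" "3 \<le> M2" "h1 = (b - a) / real M1" "h2 = (d - c) / real M2"
    and u_carrier: "\<And>k. k \<le> N \<Longrightarrow> u k \<in> carrier_vec (M1 * M2)"
    and initial: "\<And>i j. i < M1 \<Longrightarrow> j < M2 \<Longrightarrow>
      u 0 $ (i + j * M1) = u0 (a + real i * h1, c + real j * h2)"
    and scheme: "\<And>n. 1 \<le> n \<Longrightarrow> n \<le> N \<Longrightarrow>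
      fast_L1_vec \<alpha> Nq \<theta> w t u n =
        \<epsilon>\<^sup>2 \<cdot>\<^sub>v (discrete_laplacian M1 M2 h1 h2 *\<^sub>v u n) - map_vec AC_f (u (n - 1))
          - S \<cdot>\<^sub>v (u n - u (n - 1))"
    and init_bound: "max_norm (u 0) \<le> 1"
    and S_ge: "S \<ge> 2"
  shows "\<forall>k\<le>N. max_norm (u k) \<le> 1"
proof -
  let ?A = "fast_coeff \<alpha> Nq \<theta> w t"
  let ?G = "discrete_laplacian M1 M2 h1 h2"
  let ?m = "M1 * M2"
  have m: "0 < ?m" using grid by simp
  have dim: "dim_vec (u k) = ?m" if "k \<le> N" for k
    using u_carrier[OF that] by simp
  have G: "rate_matrix ?m ?G" using grid by (intro rate_matrix_discrete_laplacian)
  have "max_norm (u n) \<le> 1" if "n \<le> N" for n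
    using that
  proof (induction n rule: less_induct)
    case (less n)
    show ?case
    proof (cases "n = 0")
      case True
      then show ?thesis using init_bound by simp
    next
      case False
      then have n: "1 \<le> n" "n \<le> N" using less.prems by auto
      have past: "\<bar>u k $ p\<bar> \<le> 1" if "k < n" "p < ?m" for k p
        using less.IH[of k] max_norm_le_iff[of "u k" 1] dim[of k] m that n by auto
      \<comment> \<open>The given kernel properties say nothing about \<open>A\<^sub>0\<close> when \<open>n = 1\<close>, so its sign is read off the
        integral.\<close>
      have A0: "0 \<le> ?A n 0"
        using L1_coeff_0_nonneg[OF alpha] mesh(3)[OF n] by (simp add: fast_coeff_def)
      have A_nonneg: "0 \<le> ?A n j" if "j < n" for j
      proof (cases "j = 0")
        case False
        then have "1 \<le> j" "j \<le> n - 1" using that by auto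
        then show ?thesis using kernel_mono[OF n] by (simp add: less_imp_le)
      qed (simp add: A0)
      have A_mono: "?A n (Suc j) \<le> ?A n j" if "Suc j < n" for j
      proof -
        have "Suc j \<le> n - 1" using that by simp
        then show ?thesis using kernel_mono[OF n, of "Suc j"] by simp
      qed
      define R where "R p = ?A n 0 * u n $ p - fast_L1 \<alpha> Nq \<theta> w t (\<lambda>k. u k $ p) n
        + (S * u (n - 1) $ p - AC_f (u (n - 1) $ p))" for p
      show ?thesis
      proof (rule rate_matrix_resolvent_bound[OF G])
        show "u n \<in> carrier_vec ?m" using u_carrier n by simp
        show "0 < ?m" by (rule m)
        show "0 < ?A n 0 + S" using A0 S_ge by linarith
        show "0 \<le> \<epsilon>\<^sup>2" by simp
      next
        fix p assume p: "p < ?m"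
        have car: "?G \<in> carrier_mat ?m ?m" using G by (simp add: rate_matrix_def)
        have "fast_L1 \<alpha> Nq \<theta> w t (\<lambda>k. u k $ p) n = fast_L1_vec \<alpha> Nq \<theta> w t u n $ p"
          using p dim[of n] n by (simp add: fast_L1_vec_def)
        also have "\<dots> = \<epsilon>\<^sup>2 * (?G *\<^sub>v u n) $ p - AC_f (u (n - 1) $ p)
            - S * (u n $ p - u (n - 1) $ p)"
          unfolding scheme[OF n] using p dim[of n] dim[of "n - 1"] n car
          by (simp del: index_mult_mat_vec)
        finally show "(?A n 0 + S) * u n $ p = \<epsilon>\<^sup>2 * (?G *\<^sub>v u n) $ p + R p"
          by (simp add: R_def algebra_simps)
        have "\<bar>?A n 0 * u n $ p - fast_L1 \<alpha> Nq \<theta> w t (\<lambda>k. u k $ p) n\<bar> \<le> ?A n 0"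
          unfolding fast_L1_def
          using discrete_convolution_history_bound[of n "?A n" "\<lambda>k. u k $ p"]
            n A_nonneg A_mono past p by auto
        moreover have "\<bar>S * u (n - 1) $ p - AC_f (u (n - 1) $ p)\<bar> \<le> S"
          using stabilized_reaction_bound[OF S_ge] past[of "n - 1" p] p n by simp
        ultimately show "\<bar>R p\<bar> \<le> ?A n 0 + S" unfolding R_def by linarith
      qed
    qed
  qed
  then show ?thesis by blast
qed

end
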